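(* Let $Q$ be a basic sequence that is infinite in limit. Then: (i) the set of real numbers that are not $Q$-ratio normal of order $2$ is $1/2$-winning; (ii) the set of real numbers that are not $Q$-distribution normal is $1/2$-winning; (iii) if moreover $Q$ is $1$-divergent, then the set of real numbers that are not simply $Q$-normal is $1/2$-winning.
   Context: A basic sequence is a sequence $Q=\{q_n\}$ of integers $q_n\ge2$; it is infinite in limit if $q_n\to\infty$; with $Q_n^{(k)}=\sum_{j=1}^n\frac{1}{q_jq_{j+1}\cdots q_{j+k-1}}$, $Q$ is $k$-divergent if $Q_n^{(k)}\to\infty$. The $Q$-Cantor series expansion of $x$ is the unique expansion $x=\lfloor x\rfloor+\sum_{n\ge1}\frac{E_n}{q_1\cdots q_n}$ with $E_n\in\{0,\dots,q_n-1\}$ and $E_n\ne q_n-1$ infinitely often. A block of length $k$ is an ordered $k$-tuple of non-negative integers; $N_n^Q(B,x)$ is the number of occurrences of $B$ in $(E_j)$ starting at a position at most $n$. $x$ is $Q$-normal of order $k$ if $\lim_n N_n^Q(B,x)/Q_n^{(k)}=1$ for all blocks $B$ of length $k$; simply $Q$-normal means $Q$-normal of order $1$. $x$ is $Q$-ratio normal of order $k$ if $\lim_n N_n^Q(B,x)/N_n^Q(B',x)=1$ for all blocks $B,B'$ of length $k$. With $T_{Q,n}(x)=q_1\cdots q_nx\pmod1$, $x$ is $Q$-distribution normal if $\{T_{Q,n}(x)\}_{n\ge1}$ is uniformly distributed mod $1$. Schmidt's game on $\mathbb{R}$: Bob picks a closed interval $B_1$, Alice a closed interval $A_1\subset B_1$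 with radius $\alpha\rho(B_1)$, Bob $B_2\subset A_1$ with radius $\beta\rho(A_1)$, and so on; a set $T$ is $(\alpha,\beta)$-winning if Alice can force $\bigcap_nB_n\subset T$, and $\alpha$-winning if $(\alpha,\beta)$-winning for all $\beta\in(0,1)$. *)

theory Defs
  imports "HOL-Analysis.Analysis"
begin

text \<open>Basic sequences and digit sequences are indexed from 1; the value at index 0 is irrelevant.\<close>

definition basic_sequence :: "(nat \<Rightarrow> nat) \<Rightarrow> bool" where
  "basic_sequence q \<longleftrightarrow> (\<forall>n\<ge>1. q n \<ge> 2)"

definition infinite_in_limit :: "(nat \<Rightarrow> nat) \<Rightarrow> bool" where
  "infinite_in_limit q \<longleftrightarrow> filterlim q at_top sequentially"

definition Q_sum :: "(nat \<Rightarrow> nat) \<Rightarrow> nat \<Rightarrow> nat \<Rightarrow> real" where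
  "Q_sum q k n = (\<Sum>j=1..n. 1 / (\<Prod>i=j..<j+k. real (q i)))"

definition k_divergent :: "nat \<Rightarrow> (nat \<Rightarrow> nat) \<Rightarrow> bool" where
  "k_divergent k q \<longleftrightarrow> filterlim (Q_sum q k) at_top sequentially"

definition is_cantor_expansion :: "(nat \<Rightarrow> nat) \<Rightarrow> real \<Rightarrow> (nat \<Rightarrow> nat) \<Rightarrow> bool" where
  "is_cantor_expansion q x E \<longleftrightarrow>
     (\<forall>n\<ge>1. E n \<in> {0..q n - 1}) \<and>
     (\<exists>\<^sub>\<infinity>n. E n \<noteq> q n - 1) \<and>
     (\<lambda>n. real (E (Suc n)) / (\<Prod>j=1..Suc n. real (q j))) sums (x - of_int \<lfloor>x\<rfloor>)"

text \<open>
  For a basic sequence the digits at positions \<open>n \<ge> 1\<close> are uniquely determined by \<open>x\<close>. The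
  description ranges over a single digit because \<open>E 0\<close> is left unconstrained.
\<close>

definition cantor_digit :: "(nat \<Rightarrow> nat) \<Rightarrow> real \<Rightarrow> nat \<Rightarrow> nat" where
  "cantor_digit q x n = (THE d. \<exists>E. is_cantor_expansion q x E \<and> E n = d)"

definition block_count :: "(nat \<Rightarrow> nat) \<Rightarrow> nat list \<Rightarrow> real \<Rightarrow> nat \<Rightarrow> nat" where
  "block_count q B x n =
     card {j \<in> {1..n}. \<forall>i<length B. cantor_digit q x (j + i) = B ! i}"

definition Q_normal :: "(nat \<Rightarrow> nat) \<Rightarrow> nat \<Rightarrow> real \<Rightarrow> bool" where
  "Q_normal q k x \<longleftrightarrow>
     (\<forall>B. length B = k \<longrightarrow> (\<lambda>n. real (block_count q B x n) / Q_sum q k n) \<longlonglongrightarrow> 1)"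

definition simply_Q_normal :: "(nat \<Rightarrow> nat) \<Rightarrow> real \<Rightarrow> bool" where
  "simply_Q_normal q x \<longleftrightarrow> Q_normal q 1 x"

text \<open>
  A limit equal to 1 forces both counts to be eventually positive, so the convention
  \<open>a / 0 = 0\<close> never makes an undefined ratio count as normal.
\<close>

definition Q_ratio_normal :: "(nat \<Rightarrow> nat) \<Rightarrow> nat \<Rightarrow> real \<Rightarrow> bool" where
  "Q_ratio_normal q k x \<longleftrightarrow>
     (\<forall>B B'. length B = k \<longrightarrow> length B' = k \<longrightarrow>
        (\<lambda>n. real (block_count q B x n) / real (block_count q B' x n)) \<longlonglongrightarrow> 1)"

definition uniformly_distributed_mod_1 :: "(nat \<Rightarrow> real) \<Rightarrow> bool" where
  "uniformly_distributed_mod_1 s \<longleftrightarrow>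
     (\<forall>a b. 0 \<le> a \<longrightarrow> a < b \<longrightarrow> b \<le> 1 \<longrightarrow>
        (\<lambda>N. real (card {n \<in> {1..N}. frac (s n) \<in> {a..<b}}) / real N) \<longlonglongrightarrow> b - a)"

definition T_map :: "(nat \<Rightarrow> nat) \<Rightarrow> nat \<Rightarrow> real \<Rightarrow> real" where
  "T_map q n x = frac ((\<Prod>j=1..n. real (q j)) * x)"

definition Q_distribution_normal :: "(nat \<Rightarrow> nat) \<Rightarrow> real \<Rightarrow> bool" where
  "Q_distribution_normal q x \<longleftrightarrow> uniformly_distributed_mod_1 (\<lambda>n. T_map q n x)"

text \<open>
  In Schmidt's game a closed interval is given by its centre and its (positive) radius.
  \<open>schmidt_move \<gamma> I J\<close>: \<open>J\<close> is a legal answer to \<open>I\<close> for the player with parameter \<open>\<gamma>\<close>.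
\<close>

definition interval :: "real \<times> real \<Rightarrow> real set" where
  "interval I = cball (fst I) (snd I)"

definition schmidt_move :: "real \<Rightarrow> real \<times> real \<Rightarrow> real \<times> real \<Rightarrow> bool" where
  "schmidt_move \<gamma> I J \<longleftrightarrow> snd J = \<gamma> * snd I \<and> interval J \<subseteq> interval I"

text \<open>
  A strategy \<open>\<sigma>\<close> for Alice maps the list of Bob's moves so far to her next interval.
  \<open>bob_legal \<beta> \<sigma> B n\<close>: Bob's moves \<open>B 0, \<dots>, B n\<close> are legal against \<open>\<sigma>\<close>.
\<close>

definition alice_move ::
  "((real \<times> real) list \<Rightarrow> real \<times> real) \<Rightarrow> (nat \<Rightarrow> real \<times> real) \<Rightarrow> nat \<Rightarrow> real \<times> real" where
  "alice_move \<sigma> B n = \<sigma> (map B [0..<Suc n])"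

definition bob_legal ::
  "real \<Rightarrow> ((real \<times> real) list \<Rightarrow> real \<times> real) \<Rightarrow> (nat \<Rightarrow> real \<times> real) \<Rightarrow> nat \<Rightarrow> bool" where
  "bob_legal \<beta> \<sigma> B n \<longleftrightarrow>
     snd (B 0) > 0 \<and> (\<forall>m<n. schmidt_move \<beta> (alice_move \<sigma> B m) (B (Suc m)))"

text \<open>
  Alice's moves must be legal after every finite legal play of Bob, so that she cannot win
  vacuously by an illegal move that leaves Bob without an answer.
\<close>

definition schmidt_winning :: "real \<Rightarrow> real \<Rightarrow> real set \<Rightarrow> bool" where
  "schmidt_winning \<alpha> \<beta> S \<longleftrightarrow>
     (\<exists>\<sigma>. \<forall>B.
        (\<forall>n. bob_legal \<beta> \<sigma> B n \<longrightarrow> schmidt_move \<alpha> (B n) (alice_move \<sigma> B n)) \<and>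
        ((\<forall>n. bob_legal \<beta> \<sigma> B n) \<longrightarrow> (\<Inter>n. interval (B n)) \<subseteq> S))"

definition alpha_winning :: "real \<Rightarrow> real set \<Rightarrow> bool" where
  "alpha_winning \<alpha> S \<longleftrightarrow> (\<forall>\<beta>\<in>{0<..<1}. schmidt_winning \<alpha> \<beta> S)"

end

theory Submission imports Defs begin

text \<open>
  Let \<open>D n = q 1 \<cdots> q n\<close>. Alice always moves to the half of Bob's interval that lies away from the
  point of \<open>(1 / D n) \<int>\<close> nearest to its centre, where \<open>n\<close> is the level matching the current radius:
  \<open>D n * r \<le> 1/8 < D (n + 1) * r\<close>. Since \<open>q n \<longlongrightarrow> \<infinity>\<close>, every large level is current for at least
  two consecutive rounds: the first puts the dangerous point at worst on the boundary of Alice's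
  interval, the second moves a definite distance away from it. Thus \<open>frac (D n * x) \<ge> \<epsilon>\<close> for all
  large \<open>n\<close>, with \<open>\<epsilon>\<close> depending only on \<open>\<beta>\<close>. This contradicts uniform distribution, and it forces the
  digit \<open>0\<close> to occur only finitely often. The latter contradicts simple normality, and also ratio
  normality of order 2, because the infinitely many blocks \<open>(0, b)\<close> would all have to occur.
\<close>

section \<open>Schmidt's game\<close>

lemma schmidt_winning_mono:
  assumes "schmidt_winning \<alpha> \<beta> S" and "S \<subseteq> S'"
  shows "schmidt_winning \<alpha> \<beta> S'"
  using assms unfolding schmidt_winning_def by (meson order_trans)

lemma alpha_winning_mono:
  assumes "alpha_winning \<alpha> S" and "S \<subseteq> S'"
  shows "alpha_winning \<alpha> S'"
  using assms schmidt_winning_mono unfolding alpha_winning_def by blast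

lemma mem_interval_iff: "x \<in> interval (c, r) \<longleftrightarrow> c - r \<le> x \<and> x \<le> c + r"
  by (auto simp: interval_def dist_real_def)

text \<open>The level is recovered from the radius, so that Alice's answer depends on Bob's last
  interval alone. If no level matches, or if \<open>D n * fst I\<close> is an integer at the
  matching level, the right half is taken.\<close>

definition flees_left :: "(nat \<Rightarrow> real) \<Rightarrow> real \<times> real \<Rightarrow> bool" where
  "flees_left D I \<longleftrightarrow> (\<exists>n. D n * snd I \<le> 1/8 \<and> 1/8 < D (Suc n) * snd I \<and>
     D n * fst I < of_int (round (D n * fst I)))"

definition fleeing_half :: "(nat \<Rightarrow> real) \<Rightarrow> real \<times> real \<Rightarrow> real \<times> real" where
  "fleeing_half D I =
     (if flees_left D I then fst I - snd I / 2 else fst I + snd I / 2, snd I / 2)"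

text \<open>Monotonicity of \<open>D\<close> leaves at most one level for a given radius, so the
  existential in \<open>flees_left\<close> collapses to it.\<close>

lemma flees_left_at_level:
  assumes "mono D" and "0 < r" and "D n * r \<le> 1/8" and "1/8 < D (Suc n) * r"
  shows "flees_left D (c, r) \<longleftrightarrow> D n * c < of_int (round (D n * c))"
proof -
  have "m = n" if m: "D m * r \<le> 1/8" "1/8 < D (Suc m) * r" for m
  proof (rule ccontr)
    assume "m \<noteq> n"
    then consider "Suc m \<le> n" | "Suc n \<le> m" by linarith
    then show False
    proof cases
      case 1
      then have "D (Suc m) * r \<le> D n * r"
        using \<open>mono D\<close> \<open>0 < r\<close> by (simp add: monoD)
      then show False using m assms by linarith
    next
      case 2
      then have "D (Suc n) * r \<le> D m * r"
        using \<open>mono D\<close> \<open>0 < r\<close> by (simp add: monoD)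
      then show False using m assms by linarith
    qed
  qed
  then show ?thesis using assms(3,4) unfolding flees_left_def fst_conv snd_conv by blast
qed

lemma schmidt_move_fleeing_half:
  assumes "0 < snd I"
  shows "schmidt_move (1/2) I (fleeing_half D I)"
proof -
  obtain c r where "I = (c, r)" by (cases I)
  then show ?thesis
    using assms by (auto simp: schmidt_move_def fleeing_half_def mem_interval_iff)
qed

lemma frac_ge_of_near_int:
  fixes y :: real and p :: int
  assumes "of_int p + e \<le> y" and "y \<le> of_int p + 1 - e" and "0 < e"
  shows "e \<le> frac y"
proof -
  have "\<lfloor>y\<rfloor> = p" using assms by (intro floor_unique) auto
  then show ?thesis using assms by (simp add: frac_def)
qed

text \<open>If \<open>c\<close> is close to its nearest point of \<open>(1 / D n) \<int>\<close>, then \<open>c'\<close> has the same nearest point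
  and Alice flees twice in the same direction; otherwise \<open>x\<close> is already far from \<open>(1 / D n) \<int>\<close>.\<close>

lemma frac_ge_after_two_rounds:
  assumes D: "mono D" "0 < D n"
    and r: "0 < r" "D n * r \<le> 1/8" "1/8 < D (Suc n) * r"
    and r': "0 < r'" "D n * r' \<le> 1/8" "1/8 < D (Suc n) * r'"
    and e: "0 < e" "e \<le> 1/8" "e \<le> D n * r'"
    and sub: "interval (c', r') \<subseteq> interval (fleeing_half D (c, r))"
    and x: "x \<in> interval (fleeing_half D (c', r'))"
  shows "e \<le> frac (D n * x)"
proof -
  define d where "d = D n"
  define p where "p = round (d * c)"
  have p: "\<bar>d * c - of_int p\<bar> \<le> 1/2"
    using of_int_round_abs_le[of "d * c"] by (simp add: p_def abs_minus_commute)
  have FL: "flees_left D (c, r) \<longleftrightarrow> d * c < of_int p"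
    using flees_left_at_level[OF D(1) r] by (simp add: d_def p_def)
  have FL': "flees_left D (c', r') \<longleftrightarrow> d * c' < of_int (round (d * c'))"
    using flees_left_at_level[OF D(1) r'] by (simp add: d_def)
  have scale: "d * a \<le> d * b" if "a \<le> b" for a b
    using D(2) that by (simp add: d_def)
  have ends: "c' - r' \<in> interval (fleeing_half D (c, r))"
    "c' + r' \<in> interval (fleeing_half D (c, r))"
    using sub r'(1) by (auto simp: subset_iff mem_interval_iff)
  have x': "c' - r' \<le> x" "x \<le> c' + r'"
    using x r'(1) by (auto simp: fleeing_half_def mem_interval_iff split: if_splits)
  have dr: "d * r \<le> 1/8" "e \<le> d * r'" using r e by (auto simp: d_def)
  show ?thesis
  proof (cases "d * c < of_int p")
    case True
    with FL ends have 1: "c - r \<le> c' - r'" "c' + r' \<le> c"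
      by (auto simp: fleeing_half_def mem_interval_iff field_simps)
    have 2: "d * c - d * r \<le> d * c' - d * r'" "d * c' + d * r' \<le> d * c"
      "d * c' - d * r' \<le> d * x" "d * x \<le> d * c' + d * r'"
      using scale[OF 1(1)] scale[OF 1(2)] scale[OF x'(1)] scale[OF x'(2)]
      by (simp_all add: algebra_simps)
    show ?thesis
    \<comment> \<open>The first move keeps \<open>d * x\<close> and \<open>d * c'\<close> within 1/8
      below \<open>d * c\<close>. In the near case \<open>d * c'\<close> is thus within 3/8 of
      \<open>p\<close> and still rounds to \<open>p\<close>; otherwise \<open>d * x\<close> lies
      between \<open>p - 5/8\<close> and \<open>p - 1/4\<close>, at least 1/8 from every
      integer.\<close>
    proof (cases "of_int p - 1/4 \<le> d * c")
      case near: True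
      have "round (d * c') = p"
        using 2 near True dr e by (intro round_unique) linarith+
      with FL' True 2 dr e have "flees_left D (c', r')" by auto
      with x have "x \<le> c'" by (auto simp: fleeing_half_def mem_interval_iff)
      \<comment> \<open>The first move already gave \<open>d * c' \<le> d * c - d * r'\<close>,
        which supplies the gap \<open>e\<close> below \<open>p\<close>.\<close>
      then have "d * x \<le> d * c'" by (rule scale)
      then show ?thesis unfolding d_def[symmetric]
        using 2 near True dr e by (intro frac_ge_of_near_int[of "p - 1"]) auto
    next
      case False
      then show ?thesis unfolding d_def[symmetric]
        using 2 p dr e by (intro frac_ge_of_near_int[of "p - 1"]) auto
    qed
  next
    \<comment> \<open>Mirror image, including the tie where \<open>d * c\<close> equals
      \<open>p\<close>; the floor is now \<open>p\<close> instead of \<open>p - 1\<close>.\<close>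
    case False
    with FL ends have 1: "c \<le> c' - r'" "c' + r' \<le> c + r"
      by (auto simp: fleeing_half_def mem_interval_iff field_simps)
    have 2: "d * c \<le> d * c' - d * r'" "d * c' + d * r' \<le> d * c + d * r"
      "d * c' - d * r' \<le> d * x" "d * x \<le> d * c' + d * r'"
      using scale[OF 1(1)] scale[OF 1(2)] scale[OF x'(1)] scale[OF x'(2)]
      by (simp_all add: algebra_simps)
    show ?thesis
    proof (cases "d * c \<le> of_int p + 1/4")
      case near: True
      have "round (d * c') = p"
        using 2 near False dr e by (intro round_unique) linarith+
      with FL' False 2 dr e have "\<not> flees_left D (c', r')" by auto
      with x have "c' \<le> x" by (auto simp: fleeing_half_def mem_interval_iff)
      then have "d * c' \<le> d * x" by (rule scale)
      then show ?thesis unfolding d_def[symmetric]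
        using 2 near False dr e by (intro frac_ge_of_near_int[of p]) auto
    next
      case far: False
      then show ?thesis unfolding d_def[symmetric]
        using 2 p dr e by (intro frac_ge_of_near_int[of p]) auto
    qed
  qed
qed

text \<open>The radii shrink by the fixed factor \<open>\<beta> / 2\<close> per round while
  \<open>D\<close> grows by unbounded factors, so a late level stays current for the two rounds that
  \<open>frac_ge_after_two_rounds\<close> consumes.\<close>

lemma alpha_winning_frac_bounded_below:
  fixes D :: "nat \<Rightarrow> real"
  assumes mono: "mono D" and pos: "\<And>n. 0 < D n"
    and lim: "filterlim D at_top sequentially"
    and ratio: "filterlim (\<lambda>n. D (Suc n) / D n) at_top sequentially"
  shows "alpha_winning (1/2) {x. \<exists>e>0. \<exists>N. \<forall>n\<ge>N. e \<le> frac (D n * x)}" (is "alpha_winning _ ?S")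
  unfolding alpha_winning_def schmidt_winning_def
proof (intro ballI exI[of _ "\<lambda>l. fleeing_half D (last l)"] allI conjI impI)
  fix \<beta> :: real and B :: "nat \<Rightarrow> real \<times> real"
  assume "\<beta> \<in> {0<..<1}"
  then have \<beta>: "0 < \<beta>" "\<beta> < 1" by auto
  let ?\<sigma> = "\<lambda>l. fleeing_half D (last l)"
  have alice: "alice_move ?\<sigma> B n = fleeing_half D (B n)" for n
    by (simp add: alice_move_def)
  \<comment> \<open>Only a finite legal play is assumed, since Alice's answers must be shown legal
    after finite plays too.\<close>
  have radius: "snd (B m) = snd (B 0) * (\<beta> / 2) ^ m" if "bob_legal \<beta> ?\<sigma> B n" "m \<le> n" for m n
    using that(2)
  proof (induction m)
    case (Suc m)
    then have "snd (B (Suc m)) = \<beta> * (snd (B m) / 2)"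
      using that(1) by (simp add: bob_legal_def schmidt_move_def alice) (simp add: fleeing_half_def)
    with Suc show ?case by simp
  qed simp
  {
    fix n
    assume "bob_legal \<beta> ?\<sigma> B n"
    then have "0 < snd (B n)" using radius[of n n] \<beta> by (simp add: bob_legal_def)
    then show "schmidt_move (1/2) (B n) (alice_move ?\<sigma> B n)"
      by (simp add: alice schmidt_move_fleeing_half)
  }
  assume legal: "\<forall>n. bob_legal \<beta> ?\<sigma> B n"
  define R where "R m = snd (B m)" for m
  have R0: "0 < R 0" using legal by (auto simp: R_def bob_legal_def)
  have R: "R m = R 0 * (\<beta> / 2) ^ m" for m
    using radius[of m m] legal by (simp add: R_def)
  have Rpos: "0 < R m" for m using R[of m] R0 \<beta> by simp
  have RSuc: "R (Suc m) = R m * (\<beta> / 2)" for m using R[of m] R[of "Suc m"] by simp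
  have nested: "interval (B (Suc m)) \<subseteq> interval (fleeing_half D (B m))" for m
    using legal by (auto simp: bob_legal_def alice schmidt_move_def)
  have "(\<lambda>m. R 0 * (\<beta> / 2) ^ m) \<longlonglongrightarrow> R 0 * 0"
    using \<beta> by (intro tendsto_mult tendsto_const LIMSEQ_power_zero) auto
  then have Rlim: "R \<longlonglongrightarrow> 0" unfolding R[symmetric] mult_zero_right .
  \<comment> \<open>The first bound says that play starts before level \<open>n\<close> is reached,
    so the entering round has a predecessor; the second keeps the level current for one more
    round.\<close>
  have "\<forall>\<^sub>F n in sequentially. 1 / (8 * R 0) < D n \<and> 4 / \<beta>\<^sup>2 \<le> D (Suc n) / D n"
    by (rule eventually_conj[OF lim[unfolded filterlim_at_top_dense, rule_format]
          ratio[unfolded filterlim_at_top, rule_format]])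
  then obtain N where N: "\<And>n. N \<le> n \<Longrightarrow> 1 / (8 * R 0) < D n"
    "\<And>n. N \<le> n \<Longrightarrow> 4 / \<beta>\<^sup>2 \<le> D (Suc n) / D n"
    unfolding eventually_sequentially by blast
  show "(\<Inter>n. interval (B n)) \<subseteq> ?S"
  proof safe
    fix x assume x: "x \<in> (\<Inter>n. interval (B n))"
    \<comment> \<open>Entering the level overshoots 1/8 by at most one factor
      \<open>\<beta> / 2\<close>, and the second round costs another: 1/8 times
      \<open>(\<beta> / 2)\<^sup>2\<close>.\<close>
    have "\<beta>\<^sup>2 / 32 \<le> frac (D n * x)" if "N \<le> n" for n
    proof -
      have "\<forall>\<^sub>F m in sequentially. R m < 1 / (8 * D n)"
        using order_tendstoD(2)[OF Rlim, of "1 / (8 * D n)"] pos[of n] by simp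
      then have ex: "\<exists>m. D n * R m \<le> 1/8"
        using pos[of n] by (auto simp: eventually_sequentially field_simps intro: less_imp_le)
      define m where "m = (LEAST m. D n * R m \<le> 1/8)"
      have m: "D n * R m \<le> 1/8" unfolding m_def using ex by (rule LeastI_ex)
      have "1/8 < D n * R 0" using N(1)[OF that] R0 by (simp add: field_simps)
      with m obtain k where k: "m = Suc k" by (cases m) auto
      then have "1/8 < D n * R k" using not_less_Least[of k "\<lambda>m. D n * R m \<le> 1/8"] by (simp add: m_def)
      then have "1/8 * (\<beta> / 2) < D n * R k * (\<beta> / 2)" using \<beta> by (intro mult_strict_right_mono) auto
      then have m1: "\<beta> / 16 < D n * R m" by (simp add: k RSuc)
      then have "\<beta> / 16 * (\<beta> / 2) < D n * R m * (\<beta> / 2)" using \<beta> by (intro mult_strict_right_mono) auto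
      then have m2: "\<beta>\<^sup>2 / 32 < D n * R (Suc m)" by (simp add: RSuc power2_eq_square)
      have decr: "R (Suc m) \<le> R m" using Rpos[of m] \<beta> by (simp add: RSuc)
      \<comment> \<open>The ratio bound \<open>4 / \<beta>\<^sup>2\<close> exactly compensates the
        two factors lost, so \<open>n\<close> is still the level at round
        \<open>Suc m\<close>.\<close>
      have "1/8 = 4 / \<beta>\<^sup>2 * (\<beta>\<^sup>2 / 32)" using \<beta> by simp
      also have "\<dots> < 4 / \<beta>\<^sup>2 * (D n * R (Suc m))"
        using m2 \<beta> by (intro mult_strict_left_mono) auto
      also have "\<dots> \<le> D (Suc n) / D n * (D n * R (Suc m))"
        using N(2)[OF that] pos[of n] Rpos[of "Suc m"] by (intro mult_right_mono) auto
      also have "\<dots> = D (Suc n) * R (Suc m)" using pos[of n] by simp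
      finally have next_level': "1/8 < D (Suc n) * R (Suc m)" .
      also have "\<dots> \<le> D (Suc n) * R m" using decr pos[of "Suc n"] by simp
      finally have next_level: "1/8 < D (Suc n) * R m" .
      have m': "D n * R (Suc m) \<le> 1/8"
        using m mult_left_mono[OF decr, of "D n"] pos[of n] by linarith
      have eq: "B i = (fst (B i), R i)" for i by (simp add: R_def)
      have "x \<in> interval (B (Suc (Suc m)))" using x by blast
      then have "x \<in> interval (fleeing_half D (fst (B (Suc m)), R (Suc m)))"
        using nested[of "Suc m"] eq[of "Suc m"] by auto
      moreover have "interval (fst (B (Suc m)), R (Suc m)) \<subseteq> interval (fleeing_half D (fst (B m), R m))"
        using nested[of m] eq[of "Suc m"] eq[of m] by metis
      moreover have "\<beta>\<^sup>2 \<le> 1" using \<beta> by (simp add: power_le_one)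
      ultimately show ?thesis
        using mono pos Rpos m m' next_level next_level' m2 \<beta>
        by (intro frac_ge_after_two_rounds[of D n "R m" "R (Suc m)"]) auto
    qed
    then show "\<exists>e>0. \<exists>N. \<forall>n\<ge>N. e \<le> frac (D n * x)"
      using \<beta> by (intro exI[of _ "\<beta>\<^sup>2 / 32"]) auto
  qed
qed

section \<open>Cantor series digits\<close>

definition base_prod :: "(nat \<Rightarrow> nat) \<Rightarrow> nat \<Rightarrow> nat" where
  "base_prod q n = (\<Prod>j=1..n. q j)"

lemma base_prod_0 [simp]: "base_prod q 0 = 1"
  by (simp add: base_prod_def)

lemma base_prod_Suc [simp]: "base_prod q (Suc n) = q (Suc n) * base_prod q n"
  by (simp add: base_prod_def mult.commute)

lemma prod_real_eq_base_prod: "(\<Prod>j=1..n. real (q j)) = real (base_prod q n)"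
  by (simp add: base_prod_def)

lemma power2_le_base_prod:
  assumes "basic_sequence q"
  shows "2 ^ n \<le> base_prod q n"
proof (induction n)
  case (Suc n)
  have "2 \<le> q (Suc n)" using assms by (simp add: basic_sequence_def)
  with Suc show ?case by (simp add: mult_mono)
qed simp

lemma base_prod_pos:
  assumes "basic_sequence q"
  shows "0 < base_prod q n"
  using assms by (force simp: base_prod_def basic_sequence_def intro!: prod_pos)

lemma filterlim_base_prod:
  assumes "basic_sequence q"
  shows "filterlim (\<lambda>n. real (base_prod q n)) at_top sequentially"
proof (rule filterlim_at_top_mono[OF filterlim_real_sequentially])
  have "n \<le> base_prod q n" for n
    using power2_le_base_prod[OF assms, of n] less_exp[of n] by linarith
  then show "\<forall>\<^sub>F n in sequentially. real n \<le> real (base_prod q n)" by simp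
qed

lemma is_cantor_expansion_iff:
  "is_cantor_expansion q x E \<longleftrightarrow>
     (\<forall>n\<ge>1. E n \<in> {0..q n - 1}) \<and> (\<exists>\<^sub>\<infinity>n. E n \<noteq> q n - 1) \<and>
     (\<lambda>n. real (E (Suc n)) / real (base_prod q (Suc n))) sums frac x"
  by (simp only: is_cantor_expansion_def prod_real_eq_base_prod frac_def)

text \<open>The partial sums \<open>S n\<close> and the bounds \<open>U n = S n + 1 / P n\<close>
  enclose \<open>frac x\<close> in a half-open interval, so the integer \<open>P n * S n\<close> is
  the floor of \<open>P n * frac x\<close>. Consecutive floors determine the digit; in particular
  digits are unique.\<close>

lemma is_cantor_expansion_digit_eq:
  assumes q: "basic_sequence q" and E: "is_cantor_expansion q x E"
  shows "int (E (Suc n)) = \<lfloor>real (q (Suc n)) * frac (real (base_prod q n) * x)\<rfloor>"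
proof -
  define P where "P n = real (base_prod q n)" for n
  define S where "S n = (\<Sum>i<n. real (E (Suc i)) / P (Suc i))" for n
  define U where "U n = S n + 1 / P n" for n
  define K where "K n = \<lfloor>P n * frac x\<rfloor>" for n
  have Ppos: "0 < P n" for n using base_prod_pos[OF q] by (simp add: P_def)
  have PSuc: "P (Suc n) = real (q (Suc n)) * P n" for n by (simp add: P_def)
  have q2: "2 \<le> q (Suc n)" for n using q by (simp add: basic_sequence_def)
  have digit: "E (Suc n) + 1 \<le> q (Suc n)" for n
  proof -
    have "E (Suc n) \<in> {0..q (Suc n) - 1}" using E by (simp add: is_cantor_expansion_def)
    then show ?thesis using q2[of n] by auto
  qed
  have sums: "S \<longlonglongrightarrow> frac x"
    using E unfolding is_cantor_expansion_iff sums_def S_def P_def by blast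
  have U_eq: "U (Suc n) = U n - (real (q (Suc n)) - real (E (Suc n)) - 1) / P (Suc n)" for n
    using Ppos[of n] q2[of n] by (simp add: U_def S_def PSuc field_simps)
  have U_decr: "U (Suc n) \<le> U n" for n
  proof -
    have "real (E (Suc n)) + 1 \<le> real (q (Suc n))"
      using digit[of n] by linarith
    then show ?thesis using Ppos[of "Suc n"] by (simp add: U_eq)
  qed
  have "decseq U" using U_decr by (rule decseq_SucI)
  have "(\<lambda>n. 1 / P n) \<longlonglongrightarrow> 0"
    using tendsto_inverse_0_at_top[OF filterlim_base_prod[OF q]] by (simp add: P_def field_simps)
  from tendsto_add[OF sums this] have "U \<longlonglongrightarrow> frac x" by (simp add: U_def[abs_def])
  with \<open>decseq U\<close> have U_ge: "frac x \<le> U n" for n by (rule decseq_ge)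
  have "incseq S" using Ppos by (intro incseq_SucI) (simp add: S_def less_imp_le)
  then have S_le: "S n \<le> frac x" for n using sums by (rule incseq_le)
  \<comment> \<open>\<open>U\<close> is constant exactly across maximal digits. A non-maximal digit
    beyond \<open>n\<close> makes it drop strictly, which excludes
    \<open>frac x = U n\<close>.\<close>
  have U_gt: "frac x < U n" for n
  proof -
    have "\<exists>\<^sub>\<infinity>n. E n \<noteq> q n - 1" using E by (simp add: is_cantor_expansion_def)
    then obtain m where m: "Suc n \<le> m" "E m \<noteq> q m - 1" by (auto simp: INFM_nat_le)
    then obtain k where k: "m = Suc k" by (cases m) auto
    have "E (Suc k) + 1 < q (Suc k)" using digit[of k] m k by auto
    then have "real (E (Suc k)) + 1 < real (q (Suc k))" by linarith
    then have "U (Suc k) < U k" using Ppos[of "Suc k"] by (simp add: U_eq)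
    with U_ge[of "Suc k"] decseqD[OF \<open>decseq U\<close>, of n k] m k show ?thesis by auto
  qed
  have PS: "P (Suc n) * S (Suc n) = real (q (Suc n)) * (P n * S n) + real (E (Suc n))" for n
    using Ppos[of n] q2[of n] by (simp add: S_def PSuc field_simps)
  have "P n * S n \<in> \<int>" for n
  proof (induction n)
    case (Suc n)
    then show ?case by (simp add: PS)
  qed (simp add: S_def)
  then have K: "of_int (K n) = P n * S n" for n
  proof -
    obtain j where j: "P n * S n = of_int j" using \<open>P n * S n \<in> \<int>\<close> by (auto elim: Ints_cases)
    have "P n * S n \<le> P n * frac x" using S_le[of n] Ppos[of n] by simp
    moreover have "P n * frac x < P n * U n" using U_gt[of n] Ppos[of n] by simp
    then have "P n * frac x < P n * S n + 1" using Ppos[of n] by (simp add: U_def distrib_left)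
    ultimately have "K n = j" unfolding K_def using j by (intro floor_unique) auto
    then show ?thesis using j by simp
  qed
  \<comment> \<open>Replacing \<open>x\<close> by \<open>frac x\<close> changes
    \<open>P n * x\<close> by an integer only.\<close>
  have "P n * x = P n * frac x + of_int (int (base_prod q n) * \<lfloor>x\<rfloor>)"
    by (simp add: P_def frac_def algebra_simps)
  then have "frac (P n * x) = frac (P n * frac x)" by (simp only: frac_add_of_int_right)
  then have "real (q (Suc n)) * frac (P n * x) = P (Suc n) * frac x - of_int (int (q (Suc n)) * K n)"
    unfolding PSuc by (simp add: frac_def[of "P n * frac x"] K_def right_diff_distrib)
  then have "\<lfloor>real (q (Suc n)) * frac (P n * x)\<rfloor> = K (Suc n) - int (q (Suc n)) * K n"
    by (simp only: floor_diff_of_int K_def)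
  moreover have "of_int (K (Suc n)) = (of_int (int (q (Suc n)) * K n + int (E (Suc n))) :: real)"
    by (simp add: K PS)
  then have "K (Suc n) = int (q (Suc n)) * K n + int (E (Suc n))" by (simp only: of_int_eq_iff)
  ultimately show ?thesis by (simp add: P_def)
qed

text \<open>Greedy expansion: \<open>t n\<close> is the rescaled remainder after \<open>n\<close>
  digits, and the next digit is the integer part of \<open>q (Suc n) * t n\<close>.\<close>

lemma is_cantor_expansion_exists:
  assumes q: "basic_sequence q"
  shows "\<exists>E. is_cantor_expansion q x E"
proof -
  define P where "P n = real (base_prod q n)" for n
  define t where "t n = frac (P n * x)" for n
  define E where "E n = nat \<lfloor>real (q n) * t (n - 1)\<rfloor>" for n
  have Ppos: "0 < P n" for n using base_prod_pos[OF q] by (simp add: P_def)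
  have PSuc: "P (Suc n) = real (q (Suc n)) * P n" for n by (simp add: P_def)
  have q2: "2 \<le> q n" if "1 \<le> n" for n using q that by (simp add: basic_sequence_def)
  have t: "0 \<le> t n" "t n < 1" for n by (simp_all add: t_def frac_lt_1)
  have E_floor: "of_int \<lfloor>real (q n) * t (n - 1)\<rfloor> = real (E n)" for n
    using t by (simp add: E_def)
  have t_Suc: "t (Suc n) = real (q (Suc n)) * t n - real (E (Suc n))" for n
  proof -
    have "P (Suc n) * x = real (q (Suc n)) * t n + of_int (int (q (Suc n)) * \<lfloor>P n * x\<rfloor>)"
      by (simp add: t_def frac_def PSuc algebra_simps)
    then have "t (Suc n) = frac (real (q (Suc n)) * t n)"
      unfolding t_def[of "Suc n"] by (simp only: frac_add_of_int_right)
    then show ?thesis using E_floor[of "Suc n"] by (simp add: frac_def)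
  qed
  have "E n \<in> {0..q n - 1}" if "n \<ge> 1" for n
  proof -
    have "real (E n) \<le> real (q n) * t (n - 1)" unfolding E_floor[symmetric] by simp
    also have "\<dots> < real (q n)" using t(2)[of "n - 1"] q2[OF that] by simp
    finally show ?thesis by simp
  qed
  moreover have "\<exists>\<^sub>\<infinity>n. E n \<noteq> q n - 1"
  proof (rule ccontr)
    assume "\<not> (\<exists>\<^sub>\<infinity>n. E n \<noteq> q n - 1)"
    then obtain N where N: "\<And>n. N < n \<Longrightarrow> E n = q n - 1" by (auto simp: INFM_nat)
    \<comment> \<open>A tail of maximal digits would multiply \<open>1 - t\<close> by at least 2 at
      every step, although it is positive and never exceeds 1.\<close>
    have grow: "2 ^ k * (1 - t N) \<le> 1 - t (N + k)" for k
    proof (induction k)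
      case (Suc k)
      have "1 - t (N + Suc k) = real (q (Suc (N + k))) * (1 - t (N + k))"
        using N[of "Suc (N + k)"] q2[of "Suc (N + k)"] by (simp add: t_Suc of_nat_diff algebra_simps)
      moreover have "2 * (1 - t (N + k)) \<le> real (q (Suc (N + k))) * (1 - t (N + k))"
        using q2[of "Suc (N + k)"] t(2)[of "N + k"] by (intro mult_right_mono) auto
      ultimately show ?case using Suc by simp
    qed simp
    obtain k where "1 / (1 - t N) < 2 ^ k" using real_arch_pow[of 2] by auto
    then have "1 < 2 ^ k * (1 - t N)" using t(2)[of N] by (simp add: field_simps)
    with grow[of k] t(1)[of "N + k"] show False by linarith
  qed
  moreover have "(\<lambda>n. real (E (Suc n)) / P (Suc n)) sums frac x"
  proof -
    \<comment> \<open>The recursion for \<open>t\<close> makes the series telescope, with remainder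
      \<open>t n / P n\<close>.\<close>
    have partial: "(\<Sum>i<n. real (E (Suc i)) / P (Suc i)) = frac x - t n * (1 / P n)" for n
    proof (induction n)
      case (Suc n)
      have "real (E (Suc n)) / P (Suc n) = t n * (1 / P n) - t (Suc n) * (1 / P (Suc n))"
        using Ppos[of n] q2[of "Suc n"] by (simp add: t_Suc PSuc field_simps)
      with Suc show ?case by simp
    qed (simp add: t_def P_def)
    have "(\<lambda>n. 1 / P n) \<longlonglongrightarrow> 0"
      using tendsto_inverse_0_at_top[OF filterlim_base_prod[OF q]] by (simp add: P_def field_simps)
    then have "(\<lambda>n. t n * (1 / P n)) \<longlonglongrightarrow> 0"
    proof (rule Lim_null_comparison[rotated])
      show "\<forall>\<^sub>F n in sequentially. norm (t n * (1 / P n)) \<le> 1 / P n"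
        using t Ppos by (intro always_eventually allI) (simp add: abs_mult divide_right_mono less_imp_le)
    qed
    from tendsto_diff[OF tendsto_const this, of "frac x"] show ?thesis
      by (simp add: sums_def partial)
  qed
  ultimately show ?thesis
    unfolding is_cantor_expansion_iff P_def by blast
qed

text \<open>Existence and uniqueness make the description in \<open>cantor_digit\<close> well
  defined at positive positions.\<close>

lemma cantor_digit_eq:
  assumes "basic_sequence q"
  shows "int (cantor_digit q x (Suc n)) = \<lfloor>real (q (Suc n)) * frac (real (base_prod q n) * x)\<rfloor>"
proof -
  obtain E where E: "is_cantor_expansion q x E" using is_cantor_expansion_exists[OF assms] by blast
  have "cantor_digit q x (Suc n) = E (Suc n)"
    unfolding cantor_digit_def
    using E is_cantor_expansion_digit_eq[OF assms] by (intro the_equality) (metis of_nat_eq_iff)+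
  then show ?thesis using is_cantor_expansion_digit_eq[OF assms E] by simp
qed

section \<open>Failure of normality\<close>

text \<open>Once \<open>q n \<ge> 1 / e\<close>, the number whose floor is the digit is at least
  1.\<close>

lemma eventually_cantor_digit_nonzero:
  assumes q: "basic_sequence q" "infinite_in_limit q"
    and e: "0 < e" "\<forall>n\<ge>N. e \<le> frac (real (base_prod q n) * x)"
  shows "\<exists>M. \<forall>n>M. cantor_digit q x n \<noteq> 0"
proof -
  have "\<forall>\<^sub>F n in sequentially. nat \<lceil>1 / e\<rceil> \<le> q n"
    using q(2) unfolding infinite_in_limit_def filterlim_at_top by blast
  then obtain M where M: "\<And>n. M \<le> n \<Longrightarrow> nat \<lceil>1 / e\<rceil> \<le> q n" by (auto simp: eventually_sequentially)
  have "cantor_digit q x n \<noteq> 0" if "max M N < n" for n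
  proof -
    from that obtain k where k: "n = Suc k" by (metis gr0_implies_Suc less_zeroE neq0_conv)
    have "1 / e \<le> real (q n)" using M[of n] that by linarith
    then have "1 \<le> real (q n) * e" using e(1) by (simp add: field_simps)
    also have "\<dots> \<le> real (q n) * frac (real (base_prod q k) * x)"
      using e(2) that k by (intro mult_left_mono) auto
    finally have "1 \<le> int (cantor_digit q x n)" unfolding k cantor_digit_eq[OF q(1)] by simp
    then show ?thesis by simp
  qed
  then show ?thesis by blast
qed

text \<open>A block \<open>[0, b]\<close> can only start at a position up to \<open>M\<close>, so
  \<open>b\<close> is among the finitely many digits up to position \<open>Suc M\<close>. Ratio
  normality would require this of every \<open>b\<close>.\<close>

lemma not_Q_ratio_normal_2:
  assumes M: "\<forall>n>M. cantor_digit q x n \<noteq> 0"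
  shows "\<not> Q_ratio_normal q 2 x"
proof
  assume *: "Q_ratio_normal q 2 x"
  have "b \<in> cantor_digit q x ` {..Suc M}" for b
  proof -
    \<comment> \<open>Comparing the block with itself suffices: were it absent, every quotient would
      be 0 by the convention for division by zero.\<close>
    have "(\<lambda>n. real (block_count q [0, b] x n) / real (block_count q [0, b] x n)) \<longlonglongrightarrow> 1"
      using * unfolding Q_ratio_normal_def by (metis length_Cons list.size(3) numeral_2_eq_2)
    from order_tendstoD(1)[OF this, of 0]
    obtain n where "block_count q [0, b] x n \<noteq> 0"
      by (force simp: eventually_sequentially)
    then obtain j where "\<forall>i<length [0, b]. cantor_digit q x (j + i) = [0, b] ! i"
      unfolding block_count_def by (metis (mono_tags, lifting) card.empty empty_Collect_eq)
    then have j: "cantor_digit q x (j + 0) = 0" "cantor_digit q x (j + 1) = b"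
      by (auto simp: less_Suc_eq All_less_Suc2)
    with M have "j \<le> M" by (metis add_0_right not_le)
    with j(2) show ?thesis by force
  qed
  then have "(UNIV :: nat set) \<subseteq> cantor_digit q x ` {..Suc M}" by blast
  then show False using finite_subset infinite_UNIV_nat by blast
qed

text \<open>The count of \<open>[0]\<close> is bounded by \<open>M\<close> while the normalising sum
  diverges, so the quotient tends to 0.\<close>

lemma not_simply_Q_normal:
  assumes M: "\<forall>n>M. cantor_digit q x n \<noteq> 0" and "k_divergent 1 q"
  shows "\<not> simply_Q_normal q x"
proof
  assume "simply_Q_normal q x"
  then have 1: "(\<lambda>n. real (block_count q [0] x n) / Q_sum q 1 n) \<longlonglongrightarrow> 1"
    by (simp add: simply_Q_normal_def Q_normal_def)
  have div: "filterlim (Q_sum q 1) at_top sequentially" using assms(2) by (simp add: k_divergent_def)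
  have count: "block_count q [0] x n \<le> M" for n
  proof -
    have "{j \<in> {1..n}. \<forall>i<length [0]. cantor_digit q x (j + i) = [0] ! i} \<subseteq> {1..M}"
      using M by (auto simp: not_less[symmetric])
    from card_mono[OF _ this] show ?thesis by (simp add: block_count_def)
  qed
  have "(\<lambda>n. real (block_count q [0] x n) / Q_sum q 1 n) \<longlonglongrightarrow> 0"
  proof (rule tendsto_sandwich[OF _ _ tendsto_const tendsto_divide_0[OF tendsto_const]])
    have nonneg: "0 \<le> Q_sum q 1 n" for n by (simp add: Q_sum_def sum_nonneg prod_nonneg)
    then show "\<forall>\<^sub>F n in sequentially. 0 \<le> real (block_count q [0] x n) / Q_sum q 1 n" by simp
    show "\<forall>\<^sub>F n in sequentially. real (block_count q [0] x n) / Q_sum q 1 n \<le> real M / Q_sum q 1 n"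
      using count nonneg by (simp add: divide_right_mono)
    show "filterlim (Q_sum q 1) at_infinity sequentially"
      using div by (rule filterlim_at_top_imp_at_infinity)
  qed
  with 1 show False using LIMSEQ_unique by fastforce
qed

text \<open>The orbit visits \<open>{0..<e}\<close> at most \<open>N\<close> times, so its frequency
  there is 0 instead of \<open>e\<close>.\<close>

lemma not_Q_distribution_normal:
  assumes e: "0 < e" "\<forall>n\<ge>N. e \<le> frac (real (base_prod q n) * x)"
  shows "\<not> Q_distribution_normal q x"
proof
  assume "Q_distribution_normal q x"
  \<comment> \<open>Uniform distribution is tested only on subintervals of the unit
    interval.\<close>
  moreover have "e \<le> 1" using e(2) frac_lt_1 less_imp_le order_trans by blast
  ultimately have 1: "(\<lambda>n. real (card {i \<in> {1..n}. frac (T_map q i x) \<in> {0..<e}}) / real n) \<longlonglongrightarrow> e - 0"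
    using e(1) unfolding Q_distribution_normal_def uniformly_distributed_mod_1_def by blast
  have T: "frac (T_map q i x) = frac (real (base_prod q i) * x)" for i
    unfolding T_map_def prod_real_eq_base_prod by simp
  have count: "card {i \<in> {1..n}. frac (T_map q i x) \<in> {0..<e}} \<le> N" for n
  proof -
    have "{i \<in> {1..n}. frac (T_map q i x) \<in> {0..<e}} \<subseteq> {1..N}"
    proof safe
      fix i assume "i \<in> {1..n}" "frac (T_map q i x) \<in> {0..<e}"
      then have "1 \<le> i" "\<not> e \<le> frac (real (base_prod q i) * x)" by (auto simp: T)
      with e(2) show "i \<in> {1..N}" by (meson atLeastAtMost_iff nle_le)
    qed
    from card_mono[OF _ this] show ?thesis by simp
  qed
  have "(\<lambda>n. real (card {i \<in> {1..n}. frac (T_map q i x) \<in> {0..<e}}) / real n) \<longlonglongrightarrow> 0"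
  proof (rule tendsto_sandwich[OF _ _ tendsto_const lim_const_over_n[of "real N"]])
    show "\<forall>\<^sub>F n in sequentially.
        real (card {i \<in> {1..n}. frac (T_map q i x) \<in> {0..<e}}) / real n \<le> real N / real n"
      using count by (simp add: divide_right_mono)
  qed simp
  with 1 show False using LIMSEQ_unique e(1) by fastforce
qed

theorem theorem3p13:
  fixes q :: "nat \<Rightarrow> nat"
  assumes "basic_sequence q" and "infinite_in_limit q"
  shows "alpha_winning (1/2) {x. \<not> Q_ratio_normal q 2 x} \<and>
         alpha_winning (1/2) {x. \<not> Q_distribution_normal q x} \<and>
         (k_divergent 1 q \<longrightarrow> alpha_winning (1/2) {x. \<not> simply_Q_normal q x})"
proof -
  \<comment> \<open>A single winning set lies inside all three sets, so one strategy serves every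
    claim.\<close>
  let ?S = "{x. \<exists>e>0. \<exists>N. \<forall>n\<ge>N. e \<le> frac (real (base_prod q n) * x)}"
  have win: "alpha_winning (1/2) ?S"
  proof (rule alpha_winning_frac_bounded_below)
    show "mono (\<lambda>n. real (base_prod q n))"
    proof (rule incseq_SucI)
      fix n
      have "2 \<le> q (Suc n)" using assms(1) by (simp add: basic_sequence_def)
      then have "1 * base_prod q n \<le> q (Suc n) * base_prod q n" by (intro mult_right_mono) auto
      then show "real (base_prod q n) \<le> real (base_prod q (Suc n))" by (simp del: of_nat_mult)
    qed
    show "filterlim (\<lambda>n. real (base_prod q (Suc n)) / real (base_prod q n)) at_top sequentially"
    proof -
      have "real (base_prod q (Suc n)) / real (base_prod q n) = real (q (Suc n))" for n
        using base_prod_pos[OF assms(1), of n] by simp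
      moreover have "filterlim (\<lambda>n. real (q (Suc n))) at_top sequentially"
        using assms(2) unfolding infinite_in_limit_def
        by (intro filterlim_compose[OF filterlim_real_sequentially]
            filterlim_compose[OF _ filterlim_Suc])
      ultimately show ?thesis by presburger
    qed
  qed (use assms(1) base_prod_pos filterlim_base_prod in auto)
  have digits: "\<exists>M. \<forall>n>M. cantor_digit q x n \<noteq> 0" if "x \<in> ?S" for x
    using that eventually_cantor_digit_nonzero[OF assms] by blast
  have "?S \<subseteq> {x. \<not> Q_ratio_normal q 2 x}"
    using digits not_Q_ratio_normal_2 by blast
  moreover have "?S \<subseteq> {x. \<not> Q_distribution_normal q x}"
    using not_Q_distribution_normal by blast
  moreover have "?S \<subseteq> {x. \<not> simply_Q_normal q x}" if "k_divergent 1 q"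
    using digits not_simply_Q_normal that by blast
  ultimately show ?thesis using alpha_winning_mono[OF win] by blast
qed

end
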